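(* Let $\delta:\mathcal{D}\to\mathbf{Disc}$ be the functor $X\mapsto\delta X$, $f\mapsto f\upharpoonright_{\delta X}$, and let $\beta:\mathbf{Disc}\to\mathcal{D}$ be the restriction of the Stone-Čech compactification functor to $\mathbf{Disc}$. Then $\delta\beta\cong\mathrm{id}_{\mathbf{Disc}}$ and $\beta\delta\cong\mathrm{id}_{\mathcal{D}}$ (natural isomorphisms of functors); that is, $\beta$ and $\delta$ are equivalences of categories and natural inverses of each other.
   Context: $\mathbf{Disc}$ is the category of discrete topological spaces with all (automatically continuous) maps. For a topological space $X$, $\delta X$ is the set of isolated points of $X$, regarded as a discrete space. $\mathcal{D}$ is the category whose objects are the $\alpha$-scattered Stonean spaces and whose morphisms $X\to Y$ are the continuous maps $f:X\to Y$ with $f(\delta X)\subseteq\delta Y$. A Stonean space is a compact Hausdorff space in which the closure of every open set is open. For a space $X=(X,\tau)$, let $X^{\alpha}=(X,\tau^{\alpha})$, where $\tau^{\alpha}=\{U\setminus N : U\in\tau \text{ and } N \text{ is nowhere dense in } X\}$. A space is scattered if every nonempty subspace has an isolated point, and $X$ is $\alpha$-scattered if $X^{\alpha}$ is scattered. *)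

theory Defs
  imports "HOL-Analysis.Analysis"
begin

section \<open>Spaces\<close>

definition isolated_points :: "'a topology \<Rightarrow> 'a set" where
  "isolated_points X = {x \<in> topspace X. openin X {x}}"

definition nowhere_dense_in :: "'a topology \<Rightarrow> 'a set \<Rightarrow> bool" where
  "nowhere_dense_in X N \<longleftrightarrow> N \<subseteq> topspace X \<and> X interior_of (X closure_of N) = {}"

definition alpha_topology :: "'a topology \<Rightarrow> 'a topology" where
  "alpha_topology X =
     topology (\<lambda>S. \<exists>U N. openin X U \<and> nowhere_dense_in X N \<and> S = U - N)"

definition scattered_space :: "'a topology \<Rightarrow> bool" where
  "scattered_space X \<longleftrightarrow>
     (\<forall>S \<subseteq> topspace X. S \<noteq> {} \<longrightarrow> isolated_points (subtopology X S) \<noteq> {})"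

definition alpha_scattered_space :: "'a topology \<Rightarrow> bool" where
  "alpha_scattered_space X \<longleftrightarrow> scattered_space (alpha_topology X)"

definition Stonean_space :: "'a topology \<Rightarrow> bool" where
  "Stonean_space X \<longleftrightarrow> compact_space X \<and> Hausdorff_space X \<and>
     (\<forall>U. openin X U \<longrightarrow> openin X (X closure_of U))"

lemma nowhere_dense_in_iff:
  "nowhere_dense_in X N \<longleftrightarrow>
     N \<subseteq> topspace X \<and> (\<forall>V. openin X V \<and> V \<subseteq> X closure_of N \<longrightarrow> V = {})"
  unfolding nowhere_dense_in_def
  using interior_of_maximal[of _ "X closure_of N" X]
    interior_of_subset[of X "X closure_of N"] openin_interior_of[of X "X closure_of N"]
  by blast

lemma nowhere_dense_in_Un:
  assumes "nowhere_dense_in X M" "nowhere_dense_in X N"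
  shows "nowhere_dense_in X (M \<union> N)"
  unfolding nowhere_dense_in_iff
proof (intro conjI allI impI)
  show "M \<union> N \<subseteq> topspace X"
    using assms by (auto simp: nowhere_dense_in_iff)
  fix V assume V: "openin X V \<and> V \<subseteq> X closure_of (M \<union> N)"
  have "openin X (V - X closure_of M)"
    using V by (simp add: openin_diff)
  moreover have "V - X closure_of M \<subseteq> X closure_of N"
    using V by (auto simp: closure_of_Un)
  ultimately have "V \<subseteq> X closure_of M"
    using assms(2) unfolding nowhere_dense_in_iff by blast
  then show "V = {}"
    using V assms(1) unfolding nowhere_dense_in_iff by blast
qed

text \<open>The sets \<open>U - N\<close> do form a topology, so \<open>alpha_topology\<close> is not a junk value
  of \<^const>\<open>topology\<close>.\<close>

lemma istopology_alpha:
  "istopology (\<lambda>S. \<exists>U N. openin X U \<and> nowhere_dense_in X N \<and> S = U - N)"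
  unfolding istopology_def
proof (intro conjI allI impI)
  fix S T
  assume "\<exists>U N. openin X U \<and> nowhere_dense_in X N \<and> S = U - N"
    and "\<exists>U N. openin X U \<and> nowhere_dense_in X N \<and> T = U - N"
  then obtain U M V N where *: "openin X U" "nowhere_dense_in X M" "S = U - M"
    "openin X V" "nowhere_dense_in X N" "T = V - N" by blast
  have "S \<inter> T = (U \<inter> V) - (M \<union> N)" using * by blast
  then show "\<exists>U N. openin X U \<and> nowhere_dense_in X N \<and> S \<inter> T = U - N"
    using openin_Int[OF *(1,4)] nowhere_dense_in_Un[OF *(2,5)] by blast
next
  fix \<K>
  assume "\<forall>S\<in>\<K>. \<exists>U N. openin X U \<and> nowhere_dense_in X N \<and> S = U - N"
  then obtain u n where un: "\<And>S. S \<in> \<K> \<Longrightarrow>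
      openin X (u S) \<and> nowhere_dense_in X (n S) \<and> S = u S - n S" by (metis (lifting))
  define U where "U = \<Union>(u ` \<K>)"
  define N where "N = U - \<Union>\<K>"
  have U: "openin X U" unfolding U_def using un by blast
  have "\<Union>\<K> \<subseteq> U" unfolding U_def using un by blast
  then have eq: "\<Union>\<K> = U - N" unfolding N_def by blast
  have "nowhere_dense_in X N"
    unfolding nowhere_dense_in_iff
  proof (intro conjI allI impI)
    show "N \<subseteq> topspace X" using U openin_subset N_def by blast
    fix V assume V: "openin X V \<and> V \<subseteq> X closure_of N"
    show "V = {}"
    proof (rule ccontr)
      assume "V \<noteq> {}"
      then obtain v where "v \<in> V" "v \<in> X closure_of N" using V by blast
      then obtain y where "y \<in> N" "y \<in> V" using V unfolding in_closure_of by blast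
      then obtain S where S: "S \<in> \<K>" "y \<in> u S" unfolding N_def U_def by blast
      define W where "W = V \<inter> u S - X closure_of (n S)"
      have oVS: "openin X (V \<inter> u S)" using V un S by blast
      have W: "openin X W" unfolding W_def using oVS by (simp add: openin_diff)
      have "W \<noteq> {}"
        using un[OF S(1)] oVS \<open>y \<in> V\<close> S(2) unfolding W_def nowhere_dense_in_iff by blast
      then obtain w where "w \<in> W" "w \<in> X closure_of N" using V unfolding W_def by blast
      then obtain z where z: "z \<in> W" "z \<in> N" using W unfolding in_closure_of by blast
      have "n S \<subseteq> X closure_of (n S)"
        using un[OF S(1)] unfolding nowhere_dense_in_iff by (simp add: closure_of_subset)
      then have "z \<in> S" using un[OF S(1)] z unfolding W_def by blast
      then show False using z S unfolding N_def by blast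
    qed
  qed
  then show "\<exists>U N. openin X U \<and> nowhere_dense_in X N \<and> \<Union>\<K> = U - N"
    using U eq by blast
qed

lemma openin_alpha_topology:
  "openin (alpha_topology X) S \<longleftrightarrow>
     (\<exists>U N. openin X U \<and> nowhere_dense_in X N \<and> S = U - N)"
  unfolding alpha_topology_def topology_inverse'[OF istopology_alpha] by (rule refl)


section \<open>Categories, functors, natural isomorphisms\<close>

text \<open>Arrows are untyped, so identity and composition carry their objects:
  \<open>Comp C X Y Z g f\<close> is the composite of \<open>f : X \<rightarrow> Y\<close> and \<open>g : Y \<rightarrow> Z\<close>.\<close>

record ('o, 'm) cat =
  Ob :: "'o set"
  Hom :: "'o \<Rightarrow> 'o \<Rightarrow> 'm set"
  Ident :: "'o \<Rightarrow> 'm"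
  Comp :: "'o \<Rightarrow> 'o \<Rightarrow> 'o \<Rightarrow> 'm \<Rightarrow> 'm \<Rightarrow> 'm"

definition is_category :: "('o, 'm) cat \<Rightarrow> bool" where
  "is_category C \<longleftrightarrow>
     (\<forall>X\<in>Ob C. Ident C X \<in> Hom C X X) \<and>
     (\<forall>X\<in>Ob C. \<forall>Y\<in>Ob C. \<forall>Z\<in>Ob C. \<forall>f\<in>Hom C X Y. \<forall>g\<in>Hom C Y Z.
        Comp C X Y Z g f \<in> Hom C X Z) \<and>
     (\<forall>X\<in>Ob C. \<forall>Y\<in>Ob C. \<forall>f\<in>Hom C X Y.
        Comp C X X Y f (Ident C X) = f \<and> Comp C X Y Y (Ident C Y) f = f) \<and>
     (\<forall>W\<in>Ob C. \<forall>X\<in>Ob C. \<forall>Y\<in>Ob C. \<forall>Z\<in>Ob C.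
        \<forall>f\<in>Hom C W X. \<forall>g\<in>Hom C X Y. \<forall>h\<in>Hom C Y Z.
        Comp C W X Z (Comp C X Y Z h g) f = Comp C W Y Z h (Comp C W X Y g f))"

definition is_iso :: "('o, 'm) cat \<Rightarrow> 'o \<Rightarrow> 'o \<Rightarrow> 'm \<Rightarrow> bool" where
  "is_iso C X Y f \<longleftrightarrow> f \<in> Hom C X Y \<and>
     (\<exists>g\<in>Hom C Y X. Comp C X Y X g f = Ident C X \<and> Comp C Y X Y f g = Ident C Y)"

record ('o, 'm, 'p, 'n) func =
  ob_map :: "'o \<Rightarrow> 'p"
  mor_map :: "'o \<Rightarrow> 'o \<Rightarrow> 'm \<Rightarrow> 'n"

definition is_functor ::
  "('o, 'm) cat \<Rightarrow> ('p, 'n) cat \<Rightarrow> ('o, 'm, 'p, 'n) func \<Rightarrow> bool" where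
  "is_functor C D F \<longleftrightarrow> is_category C \<and> is_category D \<and>
     (\<forall>X\<in>Ob C. ob_map F X \<in> Ob D) \<and>
     (\<forall>X\<in>Ob C. \<forall>Y\<in>Ob C. \<forall>f\<in>Hom C X Y.
        mor_map F X Y f \<in> Hom D (ob_map F X) (ob_map F Y)) \<and>
     (\<forall>X\<in>Ob C. mor_map F X X (Ident C X) = Ident D (ob_map F X)) \<and>
     (\<forall>X\<in>Ob C. \<forall>Y\<in>Ob C. \<forall>Z\<in>Ob C. \<forall>f\<in>Hom C X Y. \<forall>g\<in>Hom C Y Z.
        mor_map F X Z (Comp C X Y Z g f) =
          Comp D (ob_map F X) (ob_map F Y) (ob_map F Z) (mor_map F Y Z g) (mor_map F X Y f))"

definition func_comp ::
  "('p, 'n, 'q, 'k) func \<Rightarrow> ('o, 'm, 'p, 'n) func \<Rightarrow> ('o, 'm, 'q, 'k) func"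
  (infixl "\<circ>\<^sub>F" 55) where
  "G \<circ>\<^sub>F F = \<lparr>ob_map = (\<lambda>X. ob_map G (ob_map F X)),
             mor_map = (\<lambda>X Y f. mor_map G (ob_map F X) (ob_map F Y) (mor_map F X Y f))\<rparr>"

definition naturally_isomorphic ::
  "('o, 'm) cat \<Rightarrow> ('p, 'n) cat \<Rightarrow> ('o, 'm, 'p, 'n) func \<Rightarrow> ('o, 'm, 'p, 'n) func \<Rightarrow> bool" where
  "naturally_isomorphic C D F G \<longleftrightarrow> is_functor C D F \<and> is_functor C D G \<and>
     (\<exists>\<eta>. (\<forall>X\<in>Ob C. is_iso D (ob_map F X) (ob_map G X) (\<eta> X)) \<and>
          (\<forall>X\<in>Ob C. \<forall>Y\<in>Ob C. \<forall>f\<in>Hom C X Y.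
             Comp D (ob_map F X) (ob_map F Y) (ob_map G Y) (\<eta> Y) (mor_map F X Y f) =
             Comp D (ob_map F X) (ob_map G X) (ob_map G Y) (mor_map G X Y f) (\<eta> X)))"


section \<open>The two categories\<close>

text \<open>A type \<open>'a\<close> plays the role of a universe: the objects are the spaces with points in \<open>'a\<close>.
  Maps are made \<^const>\<open>extensional\<close> so that equality of arrows is equality on the carrier.\<close>

definition continuous_maps :: "'a topology \<Rightarrow> 'b topology \<Rightarrow> ('a \<Rightarrow> 'b) set" where
  "continuous_maps X Y = {f \<in> extensional (topspace X). continuous_map X Y f}"

definition Disc :: "('a topology, 'a \<Rightarrow> 'a) cat" where
  "Disc = \<lparr>Ob = range discrete_topology,
           Hom = continuous_maps,
           Ident = (\<lambda>X. restrict id (topspace X)),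
           Comp = (\<lambda>X Y Z g f. compose (topspace X) g f)\<rparr>"

definition ASStonean :: "('a topology, 'a \<Rightarrow> 'a) cat" where
  "ASStonean = \<lparr>Ob = {X. Stonean_space X \<and> alpha_scattered_space X},
           Hom = (\<lambda>X Y. {f \<in> continuous_maps X Y. f ` isolated_points X \<subseteq> isolated_points Y}),
           Ident = (\<lambda>X. restrict id (topspace X)),
           Comp = (\<lambda>X Y Z g f. compose (topspace X) g f)\<rparr>"


section \<open>The functors\<close>

definition delta :: "('a topology, 'a \<Rightarrow> 'a, 'a topology, 'a \<Rightarrow> 'a) func" where
  "delta = \<lparr>ob_map = (\<lambda>X. discrete_topology (isolated_points X)),
            mor_map = (\<lambda>X Y f. restrict f (isolated_points X))\<rparr>"

text \<open>The Stone-Cech compactification of an arbitrary space \<open>X\<close>: the closure of the image of \<open>X\<close>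
  under evaluation in the cube indexed by the continuous functions from \<open>X\<close> to the unit interval.
  On arrows, the coordinate of the image of \<open>p\<close> at \<open>g\<close> is the coordinate of \<open>p\<close> at the pullback
  of \<open>g\<close>.\<close>

type_synonym 'a sc_point = "('a \<Rightarrow> real) \<Rightarrow> real"

definition unit_functions :: "'a topology \<Rightarrow> ('a \<Rightarrow> real) set" where
  "unit_functions X = continuous_maps X (top_of_set {0..1})"

definition sc_eval :: "'a topology \<Rightarrow> 'a \<Rightarrow> 'a sc_point" where
  "sc_eval X x = (\<lambda>g\<in>unit_functions X. g x)"

definition Stone_Cech :: "'a topology \<Rightarrow> 'a sc_point topology" where
  "Stone_Cech X =
     (let K = product_topology (\<lambda>_. top_of_set {0..1}) (unit_functions X)
      in subtopology K (K closure_of (sc_eval X ` topspace X)))"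

definition Stone_Cech_map ::
  "'a topology \<Rightarrow> 'a topology \<Rightarrow> ('a \<Rightarrow> 'a) \<Rightarrow> 'a sc_point \<Rightarrow> 'a sc_point" where
  "Stone_Cech_map X Y f =
     (\<lambda>p\<in>topspace (Stone_Cech X). \<lambda>g\<in>unit_functions Y. p (compose (topspace X) g f))"

definition beta ::
  "('a topology, 'a \<Rightarrow> 'a, 'a sc_point topology, 'a sc_point \<Rightarrow> 'a sc_point) func" where
  "beta = \<lparr>ob_map = Stone_Cech, mor_map = Stone_Cech_map\<rparr>"


section \<open>Change of universe\<close>

text \<open>The points of \<open>Stone_Cech X\<close> live in a larger type than those of \<open>X\<close>, so the identity
  functor has to be read as the inclusion of a universe \<open>'a\<close> into a universe \<open>'b\<close>. Given an
  injection \<open>i\<close> of types, this is the functor that relabels every point \<open>x\<close> as \<open>i x\<close>.\<close>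

definition relabel :: "('a \<Rightarrow> 'b) \<Rightarrow> 'a topology \<Rightarrow> 'b topology" where
  "relabel i X = pullback_topology (i ` topspace X) (inv i) X"

definition universe_inclusion ::
  "('a \<Rightarrow> 'b) \<Rightarrow> ('a topology, 'a \<Rightarrow> 'a, 'b topology, 'b \<Rightarrow> 'b) func" where
  "universe_inclusion i =
     \<lparr>ob_map = relabel i,
      mor_map = (\<lambda>X Y f. restrict (i \<circ> f \<circ> inv i) (i ` topspace X))\<rparr>"

lemma homeomorphic_map_relabel:
  assumes "inj i"
  shows "homeomorphic_map X (relabel i X) i"
proof -
  have top: "topspace (relabel i X) = i ` topspace X"
    unfolding relabel_def topspace_pullback_topology using assms by auto
  have "continuous_map X (relabel i X) i"
    unfolding relabel_def
  proof (rule continuous_map_pullback')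
    show "continuous_map X X (inv i \<circ> i)" using assms by simp
  qed auto
  moreover have "continuous_map (relabel i X) X (inv i)"
    using continuous_map_pullback[of X X "id" "i ` topspace X" "inv i"]
    by (simp add: relabel_def)
  ultimately have "homeomorphic_maps X (relabel i X) i (inv i)"
    unfolding homeomorphic_maps_def using assms by (auto simp: top)
  then show ?thesis using homeomorphic_maps_map by blast
qed

text \<open>Inclusions into the universe of the Stone-Cech compactifications always exist.\<close>

lemma ex_inj_sc_point: "\<exists>i :: 'a \<Rightarrow> 'a sc_point. inj i"
proof
  show "inj (\<lambda>(x::'a) g. g x :: real)"
  proof (rule injI)
    fix x y :: 'a assume "(\<lambda>g. g x :: real) = (\<lambda>g. g y)"
    then have "(indicat_real {x} x) = indicat_real {x} y" by metis
    then show "x = y" by (simp add: indicator_def split: if_splits)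
  qed
qed

end

theory Submission
  imports Defs
begin

text \<open>A Stonean space is alpha-scattered iff its isolated points are dense. Disjoint sets of
  isolated points of such a space \<open>X\<close> have disjoint closures, so for compact Hausdorff \<open>Y\<close> the closure
  in \<open>X \<times> Y\<close> of the graph of any map \<open>\<delta>X \<rightarrow> Y\<close> is again a graph: the map extends uniquely to a
  continuous map \<open>X \<rightarrow> Y\<close>. Hence \<open>\<delta>\<close> is fully faithful. The Stone-Cech compactification of a discrete
  space \<open>A\<close> is Stonean with \<open>A\<close> as its dense set of isolated points, so it suffices to match isolated
  points: the required arrows are the unique extensions of the bijections between them.\<close>

section \<open>Stonean spaces with dense isolated points\<close>

lemma isolated_points_subset: "isolated_points X \<subseteq> topspace X"
  by (auto simp: isolated_points_def)

lemma openin_subset_isolated_points: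
  assumes "A \<subseteq> isolated_points X"
  shows "openin X A"
proof -
  have "A = (\<Union>a\<in>A. {a})" by auto
  moreover have "openin X (\<Union>a\<in>A. {a})"
    using assms by (intro openin_Union) (auto simp: isolated_points_def)
  ultimately show ?thesis by simp
qed

text \<open>A dense set meets every open singleton. This bounds the isolated points of a
  compactification from above.\<close>

lemma isolated_points_dense_imp_subset:
  assumes "X closure_of S = topspace X"
  shows "isolated_points X \<subseteq> S"
  using assms unfolding isolated_points_def dense_intersects_open by blast

text \<open>A nonempty open \<open>U\<close> without isolated points would still have a point
  \<open>x\<close> isolated in the alpha topology of \<open>U\<close>. Undoing the removal of a
  nowhere dense set shows that \<open>x\<close> is isolated in \<open>X\<close> itself.\<close>

lemma alpha_scattered_imp_dense:
  assumes "Hausdorff_space X" "alpha_scattered_space X"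
  shows "X closure_of isolated_points X = topspace X"
  unfolding dense_intersects_open
proof (intro allI impI notI)
  fix U assume U: "openin X U \<and> U \<noteq> {}" and disj: "isolated_points X \<inter> U = {}"
  have ndempty: "nowhere_dense_in X {}" by (simp add: nowhere_dense_in_def)
  have "U = U - {}" by simp
  with U ndempty have "openin (alpha_topology X) U" unfolding openin_alpha_topology by blast
  then have "U \<subseteq> topspace (alpha_topology X)" by (rule openin_subset)
  then have "isolated_points (subtopology (alpha_topology X) U) \<noteq> {}"
    using assms(2) U unfolding alpha_scattered_space_def scattered_space_def by blast
  then obtain x where "openin (subtopology (alpha_topology X) U) {x}"
    unfolding isolated_points_def by blast
  then obtain V N where V: "openin X V" and N: "nowhere_dense_in X N" and x: "{x} = (V - N) \<inter> U"
    unfolding openin_subtopology openin_alpha_topology by blast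
  have "openin X (V \<inter> U)" using U V by blast
  have "x \<in> topspace X" using x V openin_subset by blast
  \<comment> \<open>Since \<open>{x}\<close> is closed, \<open>V \<inter> U - {x}\<close> is open;
    it lies inside the nowhere dense \<open>N\<close>, hence is empty.\<close>
  then have "closedin X {x}" using assms(1) by (simp add: closedin_Hausdorff_sing_eq)
  then have "openin X (V \<inter> U - {x})" using \<open>openin X (V \<inter> U)\<close> by blast
  moreover have "V \<inter> U - {x} \<subseteq> X closure_of N"
    using x N closure_of_subset[of N X] unfolding nowhere_dense_in_def by blast
  ultimately have "V \<inter> U - {x} = {}" using N unfolding nowhere_dense_in_iff by blast
  then have "V \<inter> U = {x}" using x by blast
  then have "x \<in> isolated_points X"
    using \<open>openin X (V \<inter> U)\<close> \<open>x \<in> topspace X\<close> by (simp add: isolated_points_def)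
  then show False using disj x by blast
qed

text \<open>Isolated points of \<open>X\<close> stay isolated in the finer topology. A set that
  avoids them lies in the closed complement of a dense open set, so all its subsets are nowhere
  dense and can be removed from an open set.\<close>

lemma dense_imp_alpha_scattered:
  assumes "X closure_of isolated_points X = topspace X"
  shows "alpha_scattered_space X"
  unfolding alpha_scattered_space_def scattered_space_def
proof (intro allI impI)
  fix S assume S: "S \<subseteq> topspace (alpha_topology X)" "S \<noteq> {}"
  have top: "topspace (alpha_topology X) \<subseteq> topspace X"
    using openin_topspace[of "alpha_topology X"] openin_subset
    unfolding openin_alpha_topology by blast
  have "\<exists>x\<in>S. \<exists>T. openin (alpha_topology X) T \<and> {x} = T \<inter> S"
  proof (cases "S \<inter> isolated_points X = {}")
    case False
    then obtain x where x: "x \<in> S" "x \<in> isolated_points X" by blast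
    have "nowhere_dense_in X {}" "{x} = {x} - {}" by (simp_all add: nowhere_dense_in_def)
    with x have "openin (alpha_topology X) {x}"
      unfolding openin_alpha_topology isolated_points_def by blast
    then show ?thesis using x by blast
  next
    case True
    obtain x where x: "x \<in> S" using S by blast
    define C where "C = topspace X - isolated_points X"
    have C: "closedin X C"
      unfolding C_def using openin_subset_isolated_points[OF subset_refl] by blast
    have sub: "S - {x} \<subseteq> C" unfolding C_def using S top True by blast
    have "nowhere_dense_in X (S - {x})"
      unfolding nowhere_dense_in_iff
    proof (intro conjI allI impI)
      show "S - {x} \<subseteq> topspace X" using S top by blast
      fix V assume V: "openin X V \<and> V \<subseteq> X closure_of (S - {x})"
      then have "V \<subseteq> C" using closure_of_minimal[OF sub C] by blast
      then show "V = {}" using assms V unfolding C_def dense_intersects_open by blast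
    qed
    \<comment> \<open>Removing the nowhere dense set \<open>S - {x}\<close> from the whole space
      leaves an alpha-open set that meets \<open>S\<close> in \<open>x\<close> alone.\<close>
    then have "openin (alpha_topology X) (topspace X - (S - {x}))"
      unfolding openin_alpha_topology using openin_topspace by blast
    moreover have "{x} = (topspace X - (S - {x})) \<inter> S" using x S top by blast
    ultimately show ?thesis using x by blast
  qed
  then obtain x T where "x \<in> S" "openin (alpha_topology X) T" "{x} = T \<inter> S" by blast
  then have "x \<in> isolated_points (subtopology (alpha_topology X) S)"
    using S by (auto simp: isolated_points_def openin_subtopology)
  then show "isolated_points (subtopology (alpha_topology X) S) \<noteq> {}" by blast
qed

text \<open>Eliminates the alpha topology: from here on objects are handled through density
  only.\<close>

lemma Ob_ASStonean:
  "X \<in> Ob ASStonean \<longleftrightarrow> Stonean_space X \<and> X closure_of isolated_points X = topspace X"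
  using alpha_scattered_imp_dense dense_imp_alpha_scattered
  by (auto simp: ASStonean_def Stonean_space_def)

text \<open>The open \<open>V\<close> misses the closure of \<open>U\<close>; that closure is open
  too, so it misses the closure of \<open>V\<close>.\<close>

lemma Stonean_disjoint_closures:
  assumes "Stonean_space X" "openin X U" "openin X V" "U \<inter> V = {}"
  shows "X closure_of U \<inter> X closure_of V = {}"
  using assms unfolding Stonean_space_def
  by (metis inf_commute openin_Int_closure_of_eq_empty)

lemma continuous_map_extension_isolated_points:
  assumes X: "Stonean_space X" and dense: "X closure_of isolated_points X = topspace X"
    and cY: "compact_space Y" and hY: "Hausdorff_space Y"
    and \<phi>: "\<And>d. d \<in> isolated_points X \<Longrightarrow> \<phi> d \<in> topspace Y"
  obtains F where "F \<in> extensional (topspace X)" "continuous_map X Y F"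
    "\<And>d. d \<in> isolated_points X \<Longrightarrow> F d = \<phi> d"
proof -
  define D where "D = isolated_points X"
  define P where "P = prod_topology X Y"
  define G where "G = P closure_of ((\<lambda>d. (d, \<phi> d)) ` D)"
  have topP: "topspace P = topspace X \<times> topspace Y" by (simp add: P_def)
  have DX: "D \<subseteq> topspace X" by (simp add: D_def isolated_points_subset)
  have G: "closedin P G" by (simp add: G_def)
  have graph: "(\<lambda>d. (d, \<phi> d)) ` D \<subseteq> G"
    unfolding G_def using DX \<phi> by (intro closure_of_subset) (auto simp: topP D_def)
  \<comment> \<open>Projection along the compact factor \<open>Y\<close> is a closed map. This gives
    a value over every point of \<open>X\<close>, since the image of \<open>G\<close> is closed and
    contains a dense set, and later the continuity of \<open>F\<close>.\<close>
  have fst_closed: "closedin X (fst ` C)" if "closedin P C" for C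
    using Abstract_Topological_Spaces.closed_map_fst[OF cY, of X] that
    unfolding P_def closed_map_def by blast
  have "D \<subseteq> fst ` G" using graph by force
  then have "topspace X \<subseteq> fst ` G"
    using closure_of_minimal fst_closed[OF G] dense unfolding D_def by metis
  then have ex: "\<exists>y. (x, y) \<in> G" if "x \<in> topspace X" for x
    using that by force
  \<comment> \<open>If \<open>y\<close> is a value over \<open>x\<close>, then isolated points with
    \<open>\<phi>\<close>-value near \<open>y\<close> accumulate at \<open>x\<close> or equal
    it.\<close>
  have near: "x \<in> X closure_of {d \<in> D. \<phi> d \<in> U}" if "(x, y) \<in> G" "openin Y U" "y \<in> U" for x y U
    unfolding in_closure_of
  proof (intro conjI allI impI)
    show "x \<in> topspace X" using that(1) closedin_subset[OF G] by (auto simp: topP)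
    fix T assume "x \<in> T \<and> openin X T"
    then have "openin P (T \<times> U)" "(x, y) \<in> T \<times> U"
      using that by (auto simp: P_def openin_prod_Times_iff)
    then have "\<exists>q. q \<in> (\<lambda>d. (d, \<phi> d)) ` D \<and> q \<in> T \<times> U"
      using that(1) unfolding G_def by (simp only: in_closure_of)
    then show "\<exists>d. d \<in> {d \<in> D. \<phi> d \<in> U} \<and> d \<in> T" by blast
  qed
  have uniq: "y = z" if yz: "(x, y) \<in> G" "(x, z) \<in> G" for x y z
  proof (rule ccontr)
    assume "y \<noteq> z"
    moreover have "y \<in> topspace Y" "z \<in> topspace Y"
      using yz closedin_subset[OF G] by (auto simp: topP)
    ultimately obtain U V where UV: "openin Y U" "openin Y V" "y \<in> U" "z \<in> V" "disjnt U V"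
      using hY unfolding Hausdorff_space_def by metis
    \<comment> \<open>Both sets consist of isolated points, hence are open, and they are disjoint
      because \<open>U\<close> and \<open>V\<close> are; yet by \<open>near\<close> the point
      \<open>x\<close> would lie in both closures.\<close>
    have "X closure_of {d \<in> D. \<phi> d \<in> U} \<inter> X closure_of {d \<in> D. \<phi> d \<in> V} = {}"
      using UV(5) by (intro Stonean_disjoint_closures[OF X] openin_subset_isolated_points)
        (auto simp: D_def disjnt_def)
    then show False using near[OF yz(1) UV(1,3)] near[OF yz(2) UV(2,4)] by blast
  qed
  define F where "F = (\<lambda>x\<in>topspace X. THE y. (x, y) \<in> G)"
  have F: "F x = y" if "(x, y) \<in> G" for x y
    using that uniq closedin_subset[OF G] unfolding F_def topP by (auto intro!: the_equality)
  have FG: "(x, F x) \<in> G" if "x \<in> topspace X" for x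
    using ex[OF that] F by blast
  have "continuous_map X Y F"
    unfolding continuous_map_closedin
  proof (intro conjI allI impI)
    show "F \<in> topspace X \<rightarrow> topspace Y"
      using FG closedin_subset[OF G] by (auto simp: topP)
    fix C assume C: "closedin Y C"
    \<comment> \<open>As \<open>G\<close> is the graph of \<open>F\<close>, the preimage of a closed
      set is the projection of a closed part of \<open>G\<close>.\<close>
    have "{x \<in> topspace X. F x \<in> C} = fst ` (G \<inter> topspace X \<times> C)"
    proof (intro equalityI subsetI)
      fix x assume "x \<in> {x \<in> topspace X. F x \<in> C}"
      then have "(x, F x) \<in> G \<inter> topspace X \<times> C" using FG by blast
      then show "x \<in> fst ` (G \<inter> topspace X \<times> C)" by force
    qed (auto simp: F)
    moreover have "closedin P (topspace X \<times> C)"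
      using C by (simp add: P_def closedin_prod_Times_iff)
    ultimately show "closedin X {x \<in> topspace X. F x \<in> C}"
      using fst_closed[OF closedin_Int[OF G]] by simp
  qed
  moreover have "F d = \<phi> d" if "d \<in> isolated_points X" for d
    using graph that by (intro F) (auto simp: D_def)
  moreover have "F \<in> extensional (topspace X)" by (simp add: F_def)
  ultimately show thesis using that by blast
qed

section \<open>The two categories\<close>

lemma continuous_maps_iff:
  "f \<in> continuous_maps X Y \<longleftrightarrow> f \<in> extensional (topspace X) \<and> continuous_map X Y f"
  by (simp add: continuous_maps_def)

lemma continuous_maps_in_topspace:
  "f \<in> continuous_maps X Y \<Longrightarrow> x \<in> topspace X \<Longrightarrow> f x \<in> topspace Y"
  by (auto simp: continuous_maps_iff continuous_map_def)

lemma restrict_in_continuous_maps: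
  "restrict f (topspace X) \<in> continuous_maps X Y \<longleftrightarrow> continuous_map X Y f"
  by (auto simp: continuous_maps_iff elim: continuous_map_eq)

lemma compose_in_continuous_maps:
  assumes "f \<in> continuous_maps X Y" "g \<in> continuous_maps Y Z"
  shows "compose (topspace X) g f \<in> continuous_maps X Z"
proof -
  have "continuous_map X Z (g \<circ> f)"
    using assms by (auto simp: continuous_maps_iff intro: continuous_map_compose)
  then show ?thesis
    using restrict_in_continuous_maps[of "g \<circ> f" X Z] by (simp add: compose_def o_def)
qed

lemma id_in_continuous_maps: "restrict id (topspace X) \<in> continuous_maps X X"
  using restrict_in_continuous_maps[of id X X] by simp

lemma continuous_maps_discrete:
  "continuous_maps (discrete_topology A) (discrete_topology B) = A \<rightarrow>\<^sub>E B"
  by (auto simp: continuous_maps_def PiE_def Pi_def)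

text \<open>Serves both categories, which share identities and composition. The unit and
  associativity laws are genuine equations because arrows are extensional and map carrier to
  carrier.\<close>

lemma is_category_continuous_maps:
  assumes "\<And>X Y. Hom C X Y \<subseteq> continuous_maps X Y"
    and "\<And>X. Ident C X = restrict id (topspace X)"
    and "\<And>X Y Z g f. Comp C X Y Z g f = compose (topspace X) g f"
    and "\<And>X. restrict id (topspace X) \<in> Hom C X X"
    and "\<And>X Y Z f g. f \<in> Hom C X Y \<Longrightarrow> g \<in> Hom C Y Z \<Longrightarrow> compose (topspace X) g f \<in> Hom C X Z"
  shows "is_category C"
proof -
  have ext: "f \<in> extensional (topspace X)" "f \<in> topspace X \<rightarrow> topspace Y"
    if "f \<in> Hom C X Y" for f X Y
    using subsetD[OF assms(1) that] continuous_maps_in_topspace[of f X Y]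
    by (auto simp: continuous_maps_iff)
  have "compose (topspace X) f (restrict id (topspace X)) = f"
    "compose (topspace X) (restrict id (topspace Y)) f = f" if "f \<in> Hom C X Y" for f X Y
    using ext[OF that] by (auto simp: compose_def extensional_def fun_eq_iff)
  moreover have "compose (topspace W) (compose (topspace X) h g) f
      = compose (topspace W) h (compose (topspace W) g f)"
    if "f \<in> Hom C W X" for W X f g h
    using ext(2)[OF that] by (auto simp: compose_def fun_eq_iff)
  ultimately show ?thesis unfolding is_category_def assms(2,3) using assms(4,5) by blast
qed

lemma Disc_sel:
  "Ob Disc = range discrete_topology"
  "Hom Disc = continuous_maps"
  "Ident Disc = (\<lambda>X. restrict id (topspace X))"
  "Comp Disc = (\<lambda>X Y Z g f. compose (topspace X) g f)"
  by (simp_all add: Disc_def)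

lemma ASStonean_sel:
  "Ident ASStonean = (\<lambda>X. restrict id (topspace X))"
  "Comp ASStonean = (\<lambda>X Y Z g f. compose (topspace X) g f)"
  by (simp_all add: ASStonean_def)

lemma is_category_Disc: "is_category Disc"
  by (rule is_category_continuous_maps)
    (auto simp: Disc_def id_in_continuous_maps compose_in_continuous_maps)

lemma Hom_ASStonean:
  "f \<in> Hom ASStonean X Y \<longleftrightarrow>
    f \<in> continuous_maps X Y \<and> f ` isolated_points X \<subseteq> isolated_points Y"
  by (simp add: ASStonean_def)

lemma is_category_ASStonean: "is_category ASStonean"
proof (rule is_category_continuous_maps)
  fix X show "restrict id (topspace X) \<in> Hom ASStonean X X"
    using isolated_points_subset[of X] by (auto simp: Hom_ASStonean id_in_continuous_maps)
next
  fix X Y Z :: "'a topology" and f g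
  assume f: "f \<in> Hom ASStonean X Y" and g: "g \<in> Hom ASStonean Y Z"
  have "compose (topspace X) g f d \<in> isolated_points Z" if "d \<in> isolated_points X" for d
    using that f g isolated_points_subset[of X]
    by (auto simp: Hom_ASStonean compose_def subset_iff)
  then show "compose (topspace X) g f \<in> Hom ASStonean X Z"
    using f g by (auto simp: Hom_ASStonean compose_in_continuous_maps)
qed (auto simp: ASStonean_def)

text \<open>Faithfulness of \<delta>: the isolated points are dense in \<open>X\<close>, and
  continuous maps into a Hausdorff space that agree on a dense set agree.\<close>

lemma ASStonean_arrow_eqI:
  assumes "X \<in> Ob ASStonean" "Y \<in> Ob ASStonean"
    and "f \<in> continuous_maps X Y" "g \<in> continuous_maps X Y"
    and "\<And>d. d \<in> isolated_points X \<Longrightarrow> f d = g d"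
  shows "f = g"
proof (rule extensionalityI[where A = "topspace X"])
  fix x assume "x \<in> topspace X"
  then have "x \<in> X closure_of isolated_points X" using assms(1) by (simp add: Ob_ASStonean)
  then show "f x = g x"
    using forall_in_closure_of_eq[of x X "isolated_points X" Y f g] assms
    by (auto simp: Ob_ASStonean Stonean_space_def continuous_maps_iff)
qed (use assms in \<open>auto simp: continuous_maps_iff\<close>)

text \<open>Fullness of \<delta>: the extension agrees with \<open>\<phi>\<close> on isolated
  points, so it preserves them and is an arrow.\<close>

lemma ASStonean_extension:
  assumes "X \<in> Ob ASStonean" "Y \<in> Ob ASStonean"
    and "\<And>d. d \<in> isolated_points X \<Longrightarrow> \<phi> d \<in> isolated_points Y"
  shows "\<exists>F\<in>Hom ASStonean X Y. \<forall>d\<in>isolated_points X. F d = \<phi> d"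
proof -
  have "\<phi> d \<in> topspace Y" if "d \<in> isolated_points X" for d
    using assms(3)[OF that] isolated_points_subset[of Y] by blast
  then obtain F where "F \<in> extensional (topspace X)" "continuous_map X Y F"
    and "\<And>d. d \<in> isolated_points X \<Longrightarrow> F d = \<phi> d"
    using continuous_map_extension_isolated_points[of X Y \<phi>] assms(1,2)
    unfolding Ob_ASStonean by (metis Stonean_space_def)
  then show ?thesis
    using assms(3) by (intro bexI[of _ F]) (auto simp: Hom_ASStonean continuous_maps_iff)
qed

text \<open>\<delta> reflects isomorphisms: the inverse bijection of isolated points extends to an
  arrow, and both composites are identities since they are so on isolated points.\<close>

lemma is_iso_ASStonean:
  assumes X: "X \<in> Ob ASStonean" and Y: "Y \<in> Ob ASStonean" and f: "f \<in> Hom ASStonean X Y"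
    and bij: "bij_betw f (isolated_points X) (isolated_points Y)"
  shows "is_iso ASStonean X Y f"
proof -
  define h where "h = inv_into (isolated_points X) f"
  have h: "h e \<in> isolated_points X" "f (h e) = e" if "e \<in> isolated_points Y" for e
    using that bij unfolding h_def
    by (auto simp: bij_betw_imp_surj_on f_inv_into_f inv_into_into)
  have hf: "h (f d) = d" if "d \<in> isolated_points X" for d
    using that bij unfolding h_def by (simp add: bij_betw_def)
  obtain g where g: "g \<in> Hom ASStonean Y X" and gh: "\<And>e. e \<in> isolated_points Y \<Longrightarrow> g e = h e"
    using ASStonean_extension[OF Y X, of h] h by blast
  have fd: "f d \<in> isolated_points Y" if "d \<in> isolated_points X" for d
    using that f by (auto simp: Hom_ASStonean)
  have "compose (topspace X) g f = restrict id (topspace X)"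
    using f g isolated_points_subset[of X]
    by (intro ASStonean_arrow_eqI[OF X X])
      (auto simp: Hom_ASStonean compose_in_continuous_maps id_in_continuous_maps compose_eq
        subset_iff gh hf fd)
  moreover have "compose (topspace Y) f g = restrict id (topspace Y)"
    using f g isolated_points_subset[of Y]
    by (intro ASStonean_arrow_eqI[OF Y Y])
      (auto simp: Hom_ASStonean compose_in_continuous_maps id_in_continuous_maps compose_eq
        subset_iff gh h)
  ultimately show ?thesis using f g by (auto simp: is_iso_def ASStonean_def)
qed

section \<open>Composite functors, isomorphisms of discrete spaces, functoriality of
  \<delta>\<close>

lemma is_functor_func_comp:
  assumes "is_functor C D F" "is_functor D E G"
  shows "is_functor C E (G \<circ>\<^sub>F F)"
  using assms unfolding is_functor_def func_comp_def by simp

lemma is_iso_Disc: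
  assumes "bij_betw f A B" "f \<in> extensional A"
  shows "is_iso Disc (discrete_topology A) (discrete_topology B) f"
proof -
  have "f \<in> A \<rightarrow>\<^sub>E B" using assms by (auto simp: PiE_def bij_betw_def)
  moreover have "restrict (inv_into A f) B \<in> B \<rightarrow>\<^sub>E A"
    using assms by (auto simp: bij_betw_def inv_into_into)
  moreover have "compose A (restrict (inv_into A f) B) f = restrict id A"
    "compose B f (restrict (inv_into A f) B) = restrict id B"
    using assms by (auto simp: bij_betw_def compose_def fun_eq_iff f_inv_into_f)
  ultimately show ?thesis
    unfolding is_iso_def Disc_sel continuous_maps_discrete topspace_discrete_topology by blast
qed

lemma is_functor_delta: "is_functor ASStonean Disc delta"
proof -
  have "restrict f (isolated_points X) \<in> isolated_points X \<rightarrow>\<^sub>E isolated_points Y"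
    if "f \<in> Hom ASStonean X Y" for X Y :: "'a topology" and f
    using that by (auto simp: Hom_ASStonean)
  moreover have "restrict (restrict id (topspace X)) (isolated_points X) = restrict id (isolated_points X)"
    for X :: "'a topology"
    using isolated_points_subset[of X] by (auto simp: fun_eq_iff)
  moreover have "restrict (compose (topspace X) g f) (isolated_points X)
    = compose (isolated_points X) (restrict g (isolated_points Y)) (restrict f (isolated_points X))"
    if "f \<in> Hom ASStonean X Y" for X Y :: "'a topology" and f g
    using that isolated_points_subset[of X] by (auto simp: Hom_ASStonean compose_def fun_eq_iff)
  ultimately show ?thesis
    unfolding is_functor_def ASStonean_sel Disc_sel delta_def func.simps continuous_maps_discrete
      topspace_discrete_topology
    using is_category_ASStonean is_category_Disc by blast
qed

section \<open>Relabelling\<close>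

lemma topspace_relabel: "inj i \<Longrightarrow> topspace (relabel i X) = i ` topspace X"
  using homeomorphic_imp_surjective_map[OF homeomorphic_map_relabel] by blast

lemma isolated_points_relabel:
  assumes "inj i"
  shows "isolated_points (relabel i X) = i ` isolated_points X"
proof -
  have "openin (relabel i X) {i x} \<longleftrightarrow> openin X {x}" if "x \<in> topspace X" for x
    using homeomorphic_map_openness[OF homeomorphic_map_relabel[OF assms, of X], of "{x}"] that
    by simp
  then show ?thesis by (auto simp: isolated_points_def topspace_relabel[OF assms])
qed

text \<open>Every point of the relabelled space is isolated, so every subset of it is open.\<close>

lemma relabel_discrete:
  assumes "inj i"
  shows "relabel i (discrete_topology A) = discrete_topology (i ` A)"
proof -
  have "isolated_points (relabel i (discrete_topology A)) = i ` A"
    using isolated_points_relabel[OF assms] by (simp add: isolated_points_def)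
  then show ?thesis
    using openin_subset_isolated_points[of _ "relabel i (discrete_topology A)"]
    by (intro discrete_topology_unique[THEN iffD2, symmetric])
      (auto simp: topspace_relabel[OF assms])
qed

lemma relabel_in_ASStonean:
  assumes "inj i" "X \<in> Ob ASStonean"
  shows "relabel i X \<in> Ob ASStonean"
proof -
  let ?R = "relabel i X"
  have hom: "homeomorphic_map X ?R i" by (rule homeomorphic_map_relabel[OF assms(1)])
  have cl: "?R closure_of (i ` S) = i ` (X closure_of S)" if "S \<subseteq> topspace X" for S
    using homeomorphic_map_closure_of[OF hom that] .
  have "openin ?R (?R closure_of U)" if "openin ?R U" for U
  proof -
    have "U \<subseteq> i ` topspace X"
      using openin_subset[OF that] by (simp add: topspace_relabel assms(1))
    then obtain V where V: "V \<subseteq> topspace X" "U = i ` V" by (meson subset_imageE)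
    then have "openin X V" using that homeomorphic_map_openness[OF hom] by blast
    then have "openin X (X closure_of V)"
      using assms(2) by (simp add: Ob_ASStonean Stonean_space_def)
    then show ?thesis
      using V cl homeomorphic_map_openness[OF hom closure_of_subset_topspace] by simp
  qed
  moreover have "compact_space ?R" "Hausdorff_space ?R"
    using assms(2) homeomorphic_map_imp_homeomorphic_space[OF hom]
      homeomorphic_compact_space homeomorphic_Hausdorff_space
    by (auto simp: Ob_ASStonean Stonean_space_def)
  moreover have "?R closure_of isolated_points ?R = topspace ?R"
    using assms cl[OF isolated_points_subset]
    by (simp add: isolated_points_relabel topspace_relabel Ob_ASStonean)
  ultimately show ?thesis by (simp add: Ob_ASStonean Stonean_space_def)
qed

lemma relabel_map_continuous:
  assumes "inj i" "f \<in> continuous_maps X Y"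
  shows "restrict (i \<circ> f \<circ> inv i) (i ` topspace X) \<in> continuous_maps (relabel i X) (relabel i Y)"
proof -
  have "continuous_map (relabel i X) X (inv i)"
    using continuous_map_pullback[of X X id "i ` topspace X" "inv i"] by (simp add: relabel_def)
  then have "continuous_map (relabel i X) (relabel i Y) (i \<circ> f \<circ> inv i)"
    using assms(2) homeomorphic_imp_continuous_map[OF homeomorphic_map_relabel[OF assms(1), of Y]]
    by (auto simp: continuous_maps_iff intro!: continuous_map_compose)
  then show ?thesis
    by (simp add: restrict_in_continuous_maps flip: topspace_relabel[OF assms(1)])
qed

text \<open>Treats both categories at once; preservation of identities and composites reduces to
  \<open>inv i\<close> cancelling \<open>i\<close>.\<close>

lemma is_functor_universe_inclusion:
  assumes "inj i" and C: "is_category C" and D: "is_category D"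
    and ob: "\<And>X. X \<in> Ob C \<Longrightarrow> relabel i X \<in> Ob D"
    and hom: "\<And>X Y f. f \<in> Hom C X Y \<Longrightarrow> f \<in> continuous_maps X Y \<and>
      restrict (i \<circ> f \<circ> inv i) (i ` topspace X) \<in> Hom D (relabel i X) (relabel i Y)"
    and "Ident C = (\<lambda>X. restrict id (topspace X))" "Ident D = (\<lambda>X. restrict id (topspace X))"
    and "Comp C = (\<lambda>X Y Z g f. compose (topspace X) g f)"
    and "Comp D = (\<lambda>X Y Z g f. compose (topspace X) g f)"
  shows "is_functor C D (universe_inclusion i)"
proof -
  have "restrict (i \<circ> restrict id (topspace X) \<circ> inv i) (i ` topspace X) = restrict id (i ` topspace X)"
    for X
    using assms(1) by (auto simp: fun_eq_iff)
  moreover have "restrict (i \<circ> compose (topspace X) g f \<circ> inv i) (i ` topspace X)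
     = compose (i ` topspace X) (restrict (i \<circ> g \<circ> inv i) (i ` topspace Y))
         (restrict (i \<circ> f \<circ> inv i) (i ` topspace X))"
    if "f \<in> Hom C X Y" for X Y f g
    using assms(1) hom[OF that] continuous_maps_in_topspace[of f X Y]
    by (auto simp: fun_eq_iff compose_def)
  ultimately show ?thesis
    unfolding is_functor_def universe_inclusion_def
    using assms by (simp add: topspace_relabel)
qed

lemma is_functor_universe_inclusion_Disc:
  assumes "inj i"
  shows "is_functor Disc Disc (universe_inclusion i)"
  by (rule is_functor_universe_inclusion[OF assms is_category_Disc is_category_Disc])
    (use assms in \<open>auto simp: Disc_sel relabel_discrete relabel_map_continuous
      simp del: restrict_apply o_apply\<close>)

lemma is_functor_universe_inclusion_ASStonean:
  fixes i :: "'a \<Rightarrow> 'b"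
  assumes "inj i"
  shows "is_functor ASStonean ASStonean (universe_inclusion i)"
proof (rule is_functor_universe_inclusion[OF assms is_category_ASStonean is_category_ASStonean])
  fix X Y :: "'a topology" and f assume f: "f \<in> Hom ASStonean X Y"
  then have "restrict (i \<circ> f \<circ> inv i) (i ` topspace X) ` isolated_points (relabel i X)
      \<subseteq> isolated_points (relabel i Y)"
    using isolated_points_subset[of X] assms
    by (auto simp: isolated_points_relabel[OF assms] Hom_ASStonean inj_eq)
  then show "f \<in> continuous_maps X Y \<and>
      restrict (i \<circ> f \<circ> inv i) (i ` topspace X) \<in> Hom ASStonean (relabel i X) (relabel i Y)"
    using f relabel_map_continuous[OF assms] by (auto simp: Hom_ASStonean)
qed (use assms relabel_in_ASStonean in \<open>auto simp: ASStonean_sel\<close>)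

section \<open>The Stone-Cech compactification of a discrete space\<close>

lemma sc_eval_in_cube:
  assumes "x \<in> topspace X"
  shows "sc_eval X x \<in> topspace (product_topology (\<lambda>_. top_of_set {0..1}) (unit_functions X))"
  using continuous_maps_in_topspace[OF _ assms]
  by (fastforce simp: sc_eval_def unit_functions_def)

lemma topspace_Stone_Cech:
  "topspace (Stone_Cech X) =
    product_topology (\<lambda>_. top_of_set {0..1}) (unit_functions X) closure_of (sc_eval X ` topspace X)"
  unfolding Stone_Cech_def Let_def topspace_subtopology
  by (rule Int_absorb1[OF closure_of_subset_topspace])

lemma topspace_Stone_Cech_subset:
  "topspace (Stone_Cech X) \<subseteq> unit_functions X \<rightarrow>\<^sub>E {0..1}"
  unfolding topspace_Stone_Cech
  using closure_of_subset_topspace[of "product_topology (\<lambda>_. top_of_set {0..1}) (unit_functions X)"]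
  by simp

lemma sc_eval_in_Stone_Cech: "sc_eval X ` topspace X \<subseteq> topspace (Stone_Cech X)"
  unfolding topspace_Stone_Cech
  by (intro closure_of_subset image_subsetI sc_eval_in_cube)

lemma sc_eval_dense: "Stone_Cech X closure_of (sc_eval X ` topspace X) = topspace (Stone_Cech X)"
  using sc_eval_in_Stone_Cech[of X] unfolding topspace_Stone_Cech
  by (simp add: Stone_Cech_def Let_def closure_of_subtopology_open)

lemma compact_space_Stone_Cech: "compact_space (Stone_Cech X)"
proof -
  have "compact_space (top_of_set {0..1::real})"
    by (simp add: compact_space_subtopology)
  then show ?thesis
    unfolding Stone_Cech_def Let_def
    by (intro compact_space_subtopology closedin_compact_space closedin_closure_of)
      (simp add: compact_space_product_topology)
qed

lemma Hausdorff_space_Stone_Cech: "Hausdorff_space (Stone_Cech X)"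
  unfolding Stone_Cech_def Let_def
  by (simp add: Hausdorff_space_subtopology Hausdorff_space_product_topology)

lemma continuous_map_Stone_Cech_projection:
  assumes "g \<in> unit_functions X"
  shows "continuous_map (Stone_Cech X) (top_of_set {0..1}) (\<lambda>p. p g)"
  unfolding Stone_Cech_def Let_def
  by (intro continuous_map_from_subtopology continuous_map_product_projection assms)

text \<open>On a discrete space the indicator function of \<open>C\<close> is continuous, hence a
  coordinate of the cube. This coordinate is 1 on one closure and 0 on the other.\<close>

lemma closure_sc_eval_disjoint:
  assumes "C \<subseteq> A"
  shows "Stone_Cech (discrete_topology A) closure_of (sc_eval (discrete_topology A) ` C) \<inter>
    Stone_Cech (discrete_topology A) closure_of (sc_eval (discrete_topology A) ` (A - C)) = {}"
proof -
  let ?X = "discrete_topology A"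
  define g where "g = (\<lambda>a\<in>A. indicat_real C a)"
  have g: "g \<in> unit_functions ?X"
    by (auto simp: unit_functions_def continuous_maps_iff g_def indicator_def)
  \<comment> \<open>A coordinate constant on a set of evaluations remains constant on its closure,
    since projections are continuous into a Hausdorff space.\<close>
  have val: "p g = c"
    if "p \<in> Stone_Cech ?X closure_of (sc_eval ?X ` S)" "S \<subseteq> A" "\<And>a. a \<in> S \<Longrightarrow> g a = c" "c \<in> {0..1}"
    for p S c
    using that g
    by (intro forall_in_closure_of_eq[OF that(1) _ continuous_map_Stone_Cech_projection[OF g],
          of "\<lambda>_. c"])
      (auto simp: sc_eval_def Hausdorff_space_subtopology)
  show ?thesis
    using val[of _ C 1] val[of _ "A - C" 0] assms by (fastforce simp: g_def)
qed

text \<open>By density the closures for \<open>C\<close> and \<open>A - C\<close> cover the space,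
  and they are disjoint; so each is the complement of a closed set.\<close>

lemma openin_closure_sc_eval:
  assumes "C \<subseteq> A"
  shows "openin (Stone_Cech (discrete_topology A))
    (Stone_Cech (discrete_topology A) closure_of (sc_eval (discrete_topology A) ` C))"
proof -
  let ?B = "Stone_Cech (discrete_topology A)" and ?e = "sc_eval (discrete_topology A)"
  have "?e ` A = ?e ` C \<union> ?e ` (A - C)" using assms by blast
  then have "topspace ?B = ?B closure_of (?e ` C) \<union> ?B closure_of (?e ` (A - C))"
    using sc_eval_dense[of "discrete_topology A"] closure_of_Un[of ?B "?e ` C" "?e ` (A - C)"] by simp
  then have "?B closure_of (?e ` C) = topspace ?B - ?B closure_of (?e ` (A - C))"
    using closure_sc_eval_disjoint[OF assms] by blast
  then show ?thesis by (metis closedin_closure_of openin_closedin_eq openin_diff openin_topspace)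
qed

lemma inj_on_sc_eval: "inj_on (sc_eval (discrete_topology A)) A"
proof (rule inj_onI, rule ccontr)
  fix a b assume ab: "a \<in> A" "b \<in> A" "sc_eval (discrete_topology A) a = sc_eval (discrete_topology A) b" "a \<noteq> b"
  let ?B = "Stone_Cech (discrete_topology A)" and ?e = "sc_eval (discrete_topology A)"
  have "?e a \<in> ?B closure_of (?e ` {a})" "?e b \<in> ?B closure_of (?e ` (A - {a}))"
    using ab sc_eval_in_Stone_Cech[of "discrete_topology A"]
    by (auto intro!: closure_of_subset[THEN subsetD])
  then show False using ab closure_sc_eval_disjoint[of "{a}" A] by auto
qed

text \<open>Isolated points lie in the dense image of \<open>A\<close>. Conversely a singleton of an
  evaluation is its own closure, and closures of images of subsets of \<open>A\<close> are
  open.\<close>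

lemma isolated_points_Stone_Cech:
  "isolated_points (Stone_Cech (discrete_topology A)) = sc_eval (discrete_topology A) ` A"
proof
  show "isolated_points (Stone_Cech (discrete_topology A)) \<subseteq> sc_eval (discrete_topology A) ` A"
    using isolated_points_dense_imp_subset[OF sc_eval_dense[of "discrete_topology A"]] by simp
  have "openin (Stone_Cech (discrete_topology A)) {sc_eval (discrete_topology A) a}" if "a \<in> A" for a
    using openin_closure_sc_eval[of "{a}" A] that sc_eval_in_Stone_Cech[of "discrete_topology A"]
    by (simp add: closure_of_closedin closedin_Hausdorff_sing_eq Hausdorff_space_Stone_Cech
        image_subset_iff)
  then show "sc_eval (discrete_topology A) ` A \<subseteq> isolated_points (Stone_Cech (discrete_topology A))"
    using sc_eval_in_Stone_Cech[of "discrete_topology A"] by (auto simp: isolated_points_def)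
qed

text \<open>By density an open set has the same closure as its trace on the image of
  \<open>A\<close>, which is the image of a subset of \<open>A\<close>.\<close>

lemma Stone_Cech_in_ASStonean: "Stone_Cech (discrete_topology A) \<in> Ob ASStonean"
proof -
  let ?B = "Stone_Cech (discrete_topology A)" and ?e = "sc_eval (discrete_topology A)"
  have "openin ?B (?B closure_of U)" if "openin ?B U" for U
  proof -
    have "U \<inter> ?e ` A = ?e ` {a \<in> A. ?e a \<in> U}" by blast
    moreover have "?B closure_of U = ?B closure_of (U \<inter> ?e ` A)"
      using closure_of_openin_Int_closure_of[OF that, of "?e ` A"] openin_subset[OF that]
        sc_eval_dense[of "discrete_topology A"] by (simp add: Int_absorb2)
    ultimately show ?thesis using openin_closure_sc_eval[of "{a \<in> A. ?e a \<in> U}" A] by simp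
  qed
  then show ?thesis
    using sc_eval_dense[of "discrete_topology A"]
    by (simp add: Ob_ASStonean Stonean_space_def compact_space_Stone_Cech Hausdorff_space_Stone_Cech
        isolated_points_Stone_Cech)
qed

section \<open>Functoriality\<close>

lemma unit_functions_compose:
  "f \<in> continuous_maps X Y \<Longrightarrow> g \<in> unit_functions Y \<Longrightarrow> compose (topspace X) g f \<in> unit_functions X"
  unfolding unit_functions_def by (rule compose_in_continuous_maps)

lemma Stone_Cech_map_sc_eval:
  assumes "f \<in> continuous_maps X Y" "x \<in> topspace X"
  shows "Stone_Cech_map X Y f (sc_eval X x) = sc_eval Y (f x)"
  using assms sc_eval_in_Stone_Cech[of X] unit_functions_compose[OF assms(1)]
  by (auto simp: Stone_Cech_map_def sc_eval_def compose_def fun_eq_iff image_subset_iff)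

lemma Stone_Cech_map_continuous:
  assumes f: "f \<in> continuous_maps X Y"
  shows "Stone_Cech_map X Y f \<in> continuous_maps (Stone_Cech X) (Stone_Cech Y)"
proof -
  let ?K = "product_topology (\<lambda>_. top_of_set {0..1::real}) (unit_functions Y)"
  have "continuous_map (Stone_Cech X) ?K (\<lambda>p. \<lambda>g\<in>unit_functions Y. p (compose (topspace X) g f))"
    unfolding continuous_map_componentwise
    using continuous_map_Stone_Cech_projection[OF unit_functions_compose[OF f]] by auto
  then have cont: "continuous_map (Stone_Cech X) ?K (Stone_Cech_map X Y f)"
    unfolding Stone_Cech_map_def by (simp add: restrict_continuous_map)
  \<comment> \<open>Continuity into the cube is coordinatewise. The image stays in the
    compactification of \<open>Y\<close> because evaluations go to evaluations and continuous maps
    send closures into closures.\<close>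
  have "Stone_Cech_map X Y f ` topspace (Stone_Cech X)
      \<subseteq> ?K closure_of (Stone_Cech_map X Y f ` sc_eval X ` topspace X)"
    using continuous_map_image_closure_subset[OF cont, of "sc_eval X ` topspace X"]
    by (simp add: sc_eval_dense)
  also have "\<dots> \<subseteq> topspace (Stone_Cech Y)"
    unfolding topspace_Stone_Cech
    using Stone_Cech_map_sc_eval[OF f] continuous_maps_in_topspace[OF f]
    by (intro closure_of_mono) auto
  finally have "Stone_Cech_map X Y f ` topspace (Stone_Cech X) \<subseteq> topspace (Stone_Cech Y)" .
  then have "continuous_map (Stone_Cech X) (Stone_Cech Y) (Stone_Cech_map X Y f)"
    using cont unfolding topspace_Stone_Cech[of Y]
    by (simp add: Stone_Cech_def[of Y] Let_def continuous_map_in_subtopology image_subset_iff_funcset)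
  then show ?thesis by (simp add: continuous_maps_iff Stone_Cech_map_def)
qed

lemma Stone_Cech_map_id: "Stone_Cech_map X X (restrict id (topspace X)) = restrict id (topspace (Stone_Cech X))"
proof -
  have "compose (topspace X) g (restrict id (topspace X)) = g" if "g \<in> unit_functions X" for g
    using that by (auto simp: unit_functions_def continuous_maps_iff compose_def extensional_def fun_eq_iff)
  then have "(\<lambda>g\<in>unit_functions X. p (compose (topspace X) g (restrict id (topspace X))))
      = restrict p (unit_functions X)" for p :: "'a sc_point"
    by (intro restrict_ext) simp
  \<comment> \<open>Points of the cube are extensional families, so restricting to the index set
    changes nothing.\<close>
  moreover have "restrict p (unit_functions X) = p" if "p \<in> topspace (Stone_Cech X)" for p
    using that topspace_Stone_Cech_subset[of X] by (intro extensional_restrict) (auto simp: PiE_def)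
  ultimately show ?thesis
    unfolding Stone_Cech_map_def by (intro restrict_ext) simp
qed

lemma Stone_Cech_map_compose:
  assumes f: "f \<in> continuous_maps X Y" and g: "g \<in> continuous_maps Y Z"
  shows "Stone_Cech_map X Z (compose (topspace X) g f)
    = compose (topspace (Stone_Cech X)) (Stone_Cech_map Y Z g) (Stone_Cech_map X Y f)"
proof (rule extensionalityI[where A = "topspace (Stone_Cech X)"])
  fix p assume p: "p \<in> topspace (Stone_Cech X)"
  \<comment> \<open>Pulling \<open>h\<close> back along the composite is pulling it back along
    \<open>g\<close> and then along \<open>f\<close>.\<close>
  have "compose (topspace X) h (compose (topspace X) g f)
      = compose (topspace X) (compose (topspace Y) h g) f" for h :: "'a \<Rightarrow> real"
    using continuous_maps_in_topspace[OF f] by (intro compose_assoc) auto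
  then show "Stone_Cech_map X Z (compose (topspace X) g f) p
      = compose (topspace (Stone_Cech X)) (Stone_Cech_map Y Z g) (Stone_Cech_map X Y f) p"
    using p continuous_maps_in_topspace[OF Stone_Cech_map_continuous[OF f] p]
      unit_functions_compose[OF g]
    by (simp add: compose_eq Stone_Cech_map_def cong: restrict_cong)
qed (auto simp: Stone_Cech_map_def)

lemma is_functor_beta: "is_functor Disc ASStonean beta"
proof -
  \<comment> \<open>Over discrete spaces the isolated points are exactly the evaluations, which the
    induced map preserves.\<close>
  have hom: "Stone_Cech_map X Y f \<in> Hom ASStonean (Stone_Cech X) (Stone_Cech Y)"
    if XY: "X \<in> Ob Disc" "Y \<in> Ob Disc" and f: "f \<in> continuous_maps X Y" for X Y :: "'a topology" and f
  proof -
    obtain A B where AB: "X = discrete_topology A" "Y = discrete_topology B"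
      using XY by (auto simp: Disc_sel)
    show ?thesis
      using f Stone_Cech_map_continuous[OF f] Stone_Cech_map_sc_eval[OF f] continuous_maps_in_topspace[OF f]
      by (auto simp: Hom_ASStonean AB isolated_points_Stone_Cech)
  qed
  have ob: "Stone_Cech X \<in> Ob ASStonean" if "X \<in> Ob Disc" for X :: "'a topology"
    using that Stone_Cech_in_ASStonean by (auto simp: Disc_sel)
  show ?thesis
    unfolding is_functor_def beta_def func.simps Disc_sel(2-4) ASStonean_sel
    by (intro conjI ballI is_category_Disc is_category_ASStonean Stone_Cech_map_id
        Stone_Cech_map_compose ob hom)
qed

lemma bij_betw_images:
  assumes "inj_on h D" "\<And>d. d \<in> D \<Longrightarrow> f (g d) = h d"
  shows "bij_betw f (g ` D) (h ` D)"
  unfolding bij_betw_def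
proof
  show "inj_on f (g ` D)"
    using assms by (auto intro!: inj_onI dest: inj_onD)
  show "f ` g ` D = h ` D"
    unfolding image_image using assms(2) by (rule image_cong[OF refl])
qed

section \<open>The natural isomorphisms\<close>

lemma delta_beta_natural:
  assumes "inj i"
  shows "naturally_isomorphic Disc Disc (delta \<circ>\<^sub>F beta) (universe_inclusion i)"
proof -
  \<comment> \<open>The component sends the evaluation at \<open>a\<close> to \<open>i a\<close>,
    which is well defined because evaluation is injective on a discrete space.\<close>
  define \<eta> where "\<eta> = (\<lambda>X. restrict (i \<circ> inv_into (topspace X) (sc_eval X)) (isolated_points (Stone_Cech X)))"
  have \<eta>: "\<eta> (discrete_topology A) (sc_eval (discrete_topology A) a) = i a" if "a \<in> A" for A a
    using that by (simp add: \<eta>_def isolated_points_Stone_Cech inj_on_sc_eval)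
  have "bij_betw (\<eta> (discrete_topology A)) (isolated_points (Stone_Cech (discrete_topology A))) (i ` A)" for A
    unfolding isolated_points_Stone_Cech
    by (intro bij_betw_images \<eta> inj_on_subset[OF assms] subset_UNIV)
  then have "is_iso Disc (ob_map (delta \<circ>\<^sub>F beta) X) (ob_map (universe_inclusion i) X) (\<eta> X)"
    if "X \<in> Ob Disc" for X
    using that assms is_iso_Disc[of "\<eta> X"]
    by (auto simp: Disc_sel func_comp_def delta_def beta_def universe_inclusion_def relabel_discrete \<eta>_def)
  moreover have "compose (isolated_points (Stone_Cech X)) (\<eta> Y) (restrict (Stone_Cech_map X Y f) (isolated_points (Stone_Cech X)))
     = compose (isolated_points (Stone_Cech X)) (restrict (i \<circ> f \<circ> inv i) (i ` topspace X)) (\<eta> X)"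
    if XY: "X \<in> Ob Disc" "Y \<in> Ob Disc" and f: "f \<in> continuous_maps X Y" for X Y f
  proof -
    obtain A B where AB: "X = discrete_topology A" "Y = discrete_topology B"
      using XY by (auto simp: Disc_sel)
    have "f a \<in> B" if "a \<in> A" for a
      using continuous_maps_in_topspace[OF f] that by (simp add: AB)
    then show ?thesis
      using assms Stone_Cech_map_sc_eval[OF f] unfolding compose_def
      by (intro restrict_ext) (auto simp: AB isolated_points_Stone_Cech \<eta> inj_eq)
  qed
  ultimately show ?thesis
    unfolding naturally_isomorphic_def
    using is_functor_func_comp[OF is_functor_beta is_functor_delta]
      is_functor_universe_inclusion_Disc[OF assms]
    by (intro conjI exI[of _ \<eta>])
      (auto simp: Disc_sel func_comp_def delta_def beta_def universe_inclusion_def)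
qed

lemma beta_delta_natural:
  fixes j :: "'b \<Rightarrow> 'b sc_point"
  assumes "inj j"
  shows "naturally_isomorphic ASStonean ASStonean (beta \<circ>\<^sub>F delta) (universe_inclusion j)"
proof -
  let ?d = "\<lambda>X :: 'b topology. discrete_topology (isolated_points X)"
  let ?J = "\<lambda>X f. restrict (j \<circ> f \<circ> inv j) (j ` topspace X)"
  have "\<exists>F \<in> Hom ASStonean (Stone_Cech (?d X)) (relabel j X).
      \<forall>d\<in>isolated_points X. F (sc_eval (?d X) d) = j d" if X: "X \<in> Ob ASStonean" for X
  proof -
    \<comment> \<open>The rule evaluation at \<open>d\<close> to \<open>j d\<close> is defined on
      isolated points only; fullness of \<delta> extends it to the whole compactification.\<close>
    have "\<exists>F \<in> Hom ASStonean (Stone_Cech (?d X)) (relabel j X).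
      \<forall>p\<in>isolated_points (Stone_Cech (?d X)). F p = j (inv_into (isolated_points X) (sc_eval (?d X)) p)"
      by (rule ASStonean_extension[OF Stone_Cech_in_ASStonean relabel_in_ASStonean[OF assms X]])
        (auto simp: isolated_points_Stone_Cech isolated_points_relabel assms inj_on_sc_eval)
    then show ?thesis by (auto simp: isolated_points_Stone_Cech inj_on_sc_eval)
  qed
  then obtain \<eta> where hom: "\<And>X. X \<in> Ob ASStonean \<Longrightarrow> \<eta> X \<in> Hom ASStonean (Stone_Cech (?d X)) (relabel j X)"
    and \<eta>: "\<And>X d. X \<in> Ob ASStonean \<Longrightarrow> d \<in> isolated_points X \<Longrightarrow> \<eta> X (sc_eval (?d X) d) = j d"
    by metis
  have "is_iso ASStonean (Stone_Cech (?d X)) (relabel j X) (\<eta> X)" if X: "X \<in> Ob ASStonean" for X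
  proof (rule is_iso_ASStonean[OF Stone_Cech_in_ASStonean relabel_in_ASStonean[OF assms X] hom[OF X]])
    show "bij_betw (\<eta> X) (isolated_points (Stone_Cech (?d X))) (isolated_points (relabel j X))"
      unfolding isolated_points_Stone_Cech isolated_points_relabel[OF assms]
      by (intro bij_betw_images \<eta>[OF X] inj_on_subset[OF assms] subset_UNIV)
  qed
  moreover have "Comp ASStonean (Stone_Cech (?d X)) (Stone_Cech (?d Y)) (relabel j Y) (\<eta> Y)
      (Stone_Cech_map (?d X) (?d Y) (restrict f (isolated_points X)))
    = Comp ASStonean (Stone_Cech (?d X)) (relabel j X) (relabel j Y) (?J X f) (\<eta> X)"
    if X: "X \<in> Ob ASStonean" and Y: "Y \<in> Ob ASStonean" and f: "f \<in> Hom ASStonean X Y" for X Y f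
  proof -
    let ?S = "Stone_Cech_map (?d X) (?d Y) (restrict f (isolated_points X))"
    have fd: "f d \<in> isolated_points Y" if "d \<in> isolated_points X" for d
      using f that by (auto simp: Hom_ASStonean)
    have r: "restrict f (isolated_points X) \<in> continuous_maps (?d X) (?d Y)"
      using fd by (simp add: continuous_maps_discrete)
    have S: "?S \<in> continuous_maps (Stone_Cech (?d X)) (Stone_Cech (?d Y))"
      by (rule Stone_Cech_map_continuous[OF r])
    have Jf: "?J X f \<in> continuous_maps (relabel j X) (relabel j Y)"
      using f by (intro relabel_map_continuous assms) (simp add: Hom_ASStonean)
    have \<eta>c: "\<eta> X \<in> continuous_maps (Stone_Cech (?d X)) (relabel j X)"
      "\<eta> Y \<in> continuous_maps (Stone_Cech (?d Y)) (relabel j Y)"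
      using hom X Y by (auto simp: Hom_ASStonean)
    have "compose (topspace (Stone_Cech (?d X))) (\<eta> Y) ?S
        = compose (topspace (Stone_Cech (?d X))) (?J X f) (\<eta> X)"
    \<comment> \<open>Faithfulness of \<delta> reduces naturality to isolated points, where both
      composites send the evaluation at \<open>d\<close> to \<open>j (f d)\<close>.\<close>
    proof (rule ASStonean_arrow_eqI[OF Stone_Cech_in_ASStonean relabel_in_ASStonean[OF assms Y]
          compose_in_continuous_maps[OF S \<eta>c(2)] compose_in_continuous_maps[OF \<eta>c(1) Jf]])
      fix p assume "p \<in> isolated_points (Stone_Cech (?d X))"
      then obtain d where d: "d \<in> isolated_points X" "p = sc_eval (?d X) d"
        by (auto simp: isolated_points_Stone_Cech)
      have "p \<in> topspace (Stone_Cech (?d X))" "d \<in> topspace X"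
        using d sc_eval_in_Stone_Cech[of "?d X"] isolated_points_subset[of X] by auto
      then show "compose (topspace (Stone_Cech (?d X))) (\<eta> Y) ?S p
          = compose (topspace (Stone_Cech (?d X))) (?J X f) (\<eta> X) p"
        using d Stone_Cech_map_sc_eval[OF r, of d] assms
        by (simp add: compose_eq \<eta>[OF X] \<eta>[OF Y] fd)
    qed
    then show ?thesis by (simp add: ASStonean_sel)
  qed
  ultimately show ?thesis
    unfolding naturally_isomorphic_def
    using is_functor_func_comp[OF is_functor_delta is_functor_beta]
      is_functor_universe_inclusion_ASStonean[OF assms]
    by (intro conjI exI[of _ \<eta>])
      (simp_all add: func_comp_def delta_def beta_def universe_inclusion_def)
qed

text \<open>The two composites start from unrelated universes, hence two injections;
  \<open>ex_inj_sc_point\<close> supplies both.\<close>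

theorem theorem6p1:
  fixes i :: "'a \<Rightarrow> 'a sc_point" and j :: "'b \<Rightarrow> 'b sc_point"
  assumes "inj i" and "inj j"
  shows "is_functor (Disc :: ('a topology, 'a \<Rightarrow> 'a) cat) ASStonean beta
    \<and> is_functor (ASStonean :: ('b topology, 'b \<Rightarrow> 'b) cat) Disc delta
    \<and> naturally_isomorphic Disc Disc (delta \<circ>\<^sub>F beta) (universe_inclusion i)
    \<and> naturally_isomorphic ASStonean ASStonean (beta \<circ>\<^sub>F delta) (universe_inclusion j)"
  using is_functor_beta is_functor_delta delta_beta_natural[OF assms(1)] beta_delta_natural[OF assms(2)]
  by blast

end
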